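(* In the model described in the context, set $s_n=2\left(\frac{1}{q_n}+\frac{1}{n-p_n-1}\right)$ and $b_n=\sqrt{\frac{(1-\frac{p_n+1}{n})(1-\frac{p_n+1}{n}+\frac{q_n}{n})}{2q_n/n}}$. Suppose that $\limsup_np_n/n<1$ and $q_n\to\infty$ as $n\to\infty$, and that $$s_n^{-1/2}(F_n-1)-\sqrt{n}\,\Delta_\gamma b_n\;\xrightarrow[n\to\infty]{w}\;\mathcal{N}(0,1).$$ Then, for every $\nu\in(0,1)$ not depending on $n$, $$\mathbb{P}\left(F_n>f_{q_n,n-p_n-1}^{(1-\nu)}\right)-\Phi\left(-\zeta_{1-\nu}+\sqrt{n}\,\Delta_\gamma\sqrt{\frac{(1-\frac{p_n+1}{n})(1-\frac{p_n+1}{n}+\frac{q_n}{n})}{2q_n/n}}\right)\;\xrightarrow[n\to\infty]{}\;0 .$$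
   Context: Model. For each $n$, $p_n$ is a positive integer with $p_n<n-1$ and $(y_{i,n},x_{i,n})_{i=1}^n$ are i.i.d. pairs, $y_{i,n}$ real-valued and $x_{i,n}$ a random vector in $\mathbb{R}^{p_n}$, with $\mathbb{E}[y_{1,n}|x_{1,n}]=\alpha_n+\beta_n'x_{1,n}$ and $\mathrm{Var}[y_{1,n}|x_{1,n}]=\sigma_n^2\in(0,\infty)$ (non-random). Let $\mu_n=\mathbb{E}[x_{1,n}]$, and assume $\Sigma_n=\mathrm{Var}[x_{1,n}]$ is positive definite. Write $Y=(y_{1,n},\dots,y_{n,n})'$, $X_n=[x_{1,n},\dots,x_{n,n}]'$, $\iota_n=(1,\dots,1)'\in\mathbb{R}^n$, $U=[\iota_n,X_n]$, $\gamma=(\alpha_n,\beta_n')'$. The prime denotes transpose. Hypothesis and test statistic. $R_0$ (depending on $n$) is a $q_n\times(p_n+1)$ non-random matrix of rank $q_n$, $1\le q_n\le p_n+1$, normalized to have orthonormal rows, and $r_0\in\mathbb{R}^{q_n}$; the null hypothesis is $H_0:R_0\gamma=r_0$. With $\hat\gamma_n=(U'U)^{-1}U'Y$, $$F_n=\frac{(R_0\hat\gamma_n-r_0)'(R_0(U'U)^{-1}R_0')^{-1}(R_0\hat\gamma_n-r_0)/q_n}{\|Y-U\hat\gamma_n\|^2/(n-p_n-1)}$$ whenever all appearing quantities are well defined, and $F_n=0$ otherwise. Further, $S_n=\begin{bmatrix}1&\mu_n'\\ \mu_n&\Sigma_n+\mu_n\mu_n'\end{bmatrix}$ and $\Delta_\gamma=(R_0\gamma-r_0)'(R_0S_n^{-1}R_0')^{-1}(R_0\gamma-r_0)/\sigma_n^2$.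 Notation. $f^{(1-\nu)}_{q,m}$ is the $1-\nu$ quantile of the (central) $F$-distribution with $q$ and $m$ degrees of freedom; $\Phi$ is the standard normal cdf and $\zeta_{1-\nu}=\Phi^{-1}(1-\nu)$; $\xrightarrow{w}$ is weak convergence. *)

theory Defs
  imports "HOL-Probability.Probability" "Jordan_Normal_Form.DL_Rank"
    "Jordan_Normal_Form.Gauss_Jordan_Elimination"
begin

hide_type (open) Finite_Cartesian_Product.vec
hide_const (open) Finite_Cartesian_Product.vec Finite_Cartesian_Product.mat
  Finite_Cartesian_Product.row Determinants.det
no_notation inner (infix \<open>\<bullet>\<close> 70)
no_notation Finite_Cartesian_Product.vec.vec_nth (infixl \<open>$\<close> 90)

section \<open>Matrices\<close>

text \<open>Meaningful for invertible matrices only.\<close>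

definition mat_inv :: "real mat \<Rightarrow> real mat" where
  "mat_inv A = the (mat_inverse A)"

definition positive_definite :: "real mat \<Rightarrow> bool" where
  "positive_definite A \<longleftrightarrow> square_mat A \<and> A\<^sup>T = A \<and>
     (\<forall>v \<in> carrier_vec (dim_row A). v \<noteq> 0\<^sub>v (dim_row A) \<longrightarrow> v \<bullet> (A *\<^sub>v v) > 0)"

definition orthonormal_rows :: "real mat \<Rightarrow> bool" where
  "orthonormal_rows A \<longleftrightarrow>
     (\<forall>i < dim_row A. \<forall>j < dim_row A. row A i \<bullet> row A j = (if i = j then 1 else 0))"

section \<open>Random vectors\<close>

text \<open>The Borel sets of \<open>\<real>\<^sup>p\<close>, transported to the vectors of length \<open>p\<close> along the
  identification with functions on \<open>{..<p}\<close>.\<close>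

definition vec_borel :: "nat \<Rightarrow> real vec measure" where
  "vec_borel p =
     vimage_algebra (carrier_vec p) (\<lambda>v. \<lambda>j\<in>{..<p}. v $ j) (Pi\<^sub>M {..<p} (\<lambda>_. borel))"

definition mean_vec :: "'a measure \<Rightarrow> nat \<Rightarrow> ('a \<Rightarrow> real vec) \<Rightarrow> real vec" where
  "mean_vec M p X = vec p (\<lambda>j. \<integral>\<omega>. X \<omega> $ j \<partial>M)"

definition cov_mat :: "'a measure \<Rightarrow> nat \<Rightarrow> ('a \<Rightarrow> real vec) \<Rightarrow> real mat" where
  "cov_mat M p X = mat p p (\<lambda>(j, k).
     \<integral>\<omega>. (X \<omega> $ j - mean_vec M p X $ j) * (X \<omega> $ k - mean_vec M p X $ k) \<partial>M)"

definition real_cond_var :: "'a measure \<Rightarrow> 'a measure \<Rightarrow> ('a \<Rightarrow> real) \<Rightarrow> 'a \<Rightarrow> real" where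
  "real_cond_var M G f = real_cond_exp M G (\<lambda>\<omega>. (f \<omega> - real_cond_exp M G f \<omega>)\<^sup>2)"

section \<open>The model for a fixed sample size \<open>n\<close>\<close>

text \<open>Observations are indexed by \<open>1, \<dots>, n\<close>, vector and matrix entries from \<open>0\<close>.
  The integrability assumptions express that the conditional mean of \<open>y 1\<close> and the
  covariance matrix of \<open>x 1\<close> exist; without them the library operators return junk values.\<close>

locale linear_model = prob_space M
  for M :: "'a measure" +
  fixes n p :: nat
    and y :: "nat \<Rightarrow> 'a \<Rightarrow> real"
    and x :: "nat \<Rightarrow> 'a \<Rightarrow> real vec"
    and \<alpha> :: real and \<beta> :: "real vec" and \<sigma> :: real
  assumes p_pos: "0 < p"
    and p_less: "p + 1 < n"
    and \<beta>_carrier: "\<beta> \<in> carrier_vec p"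
    and \<sigma>_pos: "0 < \<sigma>"
    and indep: "indep_vars (\<lambda>_. borel \<Otimes>\<^sub>M vec_borel p) (\<lambda>i \<omega>. (y i \<omega>, x i \<omega>)) {1..n}"
    and ident: "\<And>i. i \<in> {1..n} \<Longrightarrow>
      distr M (borel \<Otimes>\<^sub>M vec_borel p) (\<lambda>\<omega>. (y i \<omega>, x i \<omega>)) =
      distr M (borel \<Otimes>\<^sub>M vec_borel p) (\<lambda>\<omega>. (y 1 \<omega>, x 1 \<omega>))"
    and y_integrable: "integrable M (y 1)"
    and x_square_integrable: "\<And>j. j < p \<Longrightarrow> integrable M (\<lambda>\<omega>. (x 1 \<omega> $ j)\<^sup>2)"
    and cond_mean: "AE \<omega> in M.
      real_cond_exp M (vimage_algebra (space M) (x 1) (vec_borel p)) (y 1) \<omega> =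
      \<alpha> + \<beta> \<bullet> x 1 \<omega>"
    and cond_var: "AE \<omega> in M.
      real_cond_var M (vimage_algebra (space M) (x 1) (vec_borel p)) (y 1) \<omega> = \<sigma>\<^sup>2"
    and cov_pos_def: "positive_definite (cov_mat M p (x 1))"

definition linear_restriction :: "nat \<Rightarrow> nat \<Rightarrow> real mat \<Rightarrow> real vec \<Rightarrow> bool" where
  "linear_restriction p q R r \<longleftrightarrow> 1 \<le> q \<and> q \<le> p + 1 \<and>
     R \<in> carrier_mat q (p + 1) \<and> vec_space.rank q R = q \<and> orthonormal_rows R \<and>
     r \<in> carrier_vec q"

definition response_vec :: "nat \<Rightarrow> (nat \<Rightarrow> 'a \<Rightarrow> real) \<Rightarrow> 'a \<Rightarrow> real vec" where
  "response_vec n y \<omega> = vec n (\<lambda>i. y (i + 1) \<omega>)"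

definition design_mat :: "nat \<Rightarrow> nat \<Rightarrow> (nat \<Rightarrow> 'a \<Rightarrow> real vec) \<Rightarrow> 'a \<Rightarrow> real mat" where
  "design_mat n p x \<omega> = mat_of_rows (p + 1) (map (\<lambda>i. vCons 1 (x i \<omega>)) [1..<n + 1])"

definition ols :: "real mat \<Rightarrow> real vec \<Rightarrow> real vec" where
  "ols U Y = (mat_inv (U\<^sup>T * U) * U\<^sup>T) *\<^sub>v Y"

definition rss :: "real mat \<Rightarrow> real vec \<Rightarrow> real" where
  "rss U Y = (Y - U *\<^sub>v ols U Y) \<bullet> (Y - U *\<^sub>v ols U Y)"

definition F_stat :: "nat \<Rightarrow> nat \<Rightarrow> nat \<Rightarrow> real mat \<Rightarrow> real vec \<Rightarrow> real mat \<Rightarrow> real vec \<Rightarrow> real" where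
  "F_stat n p q R r U Y =
     (let W = R * mat_inv (U\<^sup>T * U) * R\<^sup>T; d = R *\<^sub>v ols U Y - r
      in if invertible_mat (U\<^sup>T * U) \<and> invertible_mat W \<and> rss U Y \<noteq> 0
         then (d \<bullet> (mat_inv W *\<^sub>v d) / real q) / (rss U Y / (real n - real p - 1))
         else 0)"

text \<open>The second moment matrix of \<open>(1, X')'\<close>, in terms of \<open>\<mu> = E X\<close> and \<open>\<Sigma> = Var X\<close>.\<close>

definition moment_mat :: "real vec \<Rightarrow> real mat \<Rightarrow> real mat" where
  "moment_mat \<mu> \<Sigma> =
     four_block_mat (1\<^sub>m 1) (mat_of_row \<mu>)
       ((mat_of_row \<mu>)\<^sup>T) (\<Sigma> + (mat_of_row \<mu>)\<^sup>T * mat_of_row \<mu>)"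

definition noncentrality ::
  "real mat \<Rightarrow> real vec \<Rightarrow> real mat \<Rightarrow> real vec \<Rightarrow> real \<Rightarrow> real" where
  "noncentrality R r S \<gamma> \<sigma> =
     (let d = R *\<^sub>v \<gamma> - r in d \<bullet> (mat_inv (R * mat_inv S * R\<^sup>T) *\<^sub>v d) / \<sigma>\<^sup>2)"

section \<open>The \<open>F\<close>-distribution and quantiles\<close>

definition chi_square_distribution :: "nat \<Rightarrow> real measure" where
  "chi_square_distribution k =
     distr (Pi\<^sub>M {..<k} (\<lambda>_. std_normal_distribution)) borel (\<lambda>z. \<Sum>i<k. (z i)\<^sup>2)"

definition F_distribution :: "nat \<Rightarrow> nat \<Rightarrow> real measure" where
  "F_distribution q m =
     distr (chi_square_distribution q \<Otimes>\<^sub>M chi_square_distribution m) borel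
       (\<lambda>(a, b). (a / real q) / (b / real m))"

definition quantile :: "real measure \<Rightarrow> real \<Rightarrow> real" where
  "quantile D u = Inf {t. u \<le> cdf D t}"

abbreviation std_normal_cdf :: "real \<Rightarrow> real" where
  "std_normal_cdf \<equiv> cdf std_normal_distribution"

end

theory Submission
  imports Defs
begin

text \<open>By the assumed central limit theorem and Polya's theorem, the distribution functions of the
  normalized statistics converge uniformly to that of the standard normal distribution, so they may
  be evaluated at the moving points \<open>a\<^sub>n - c\<^sub>n\<close>, where \<open>a\<^sub>n\<close> is the normalized critical value and
  \<open>c\<^sub>n = sqrt n * \<Delta>\<^sub>n * b\<^sub>n\<close> may be unbounded. It remains to see that \<open>a\<^sub>n\<close> tends to the normal
  quantile. This is a central limit theorem for the central \<open>F\<close>-distribution with both degrees of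
  freedom tending to infinity at unrelated rates: after linearization it concerns a combination,
  with squared weights adding up to \<open>1\<close>, of two independent standardized chi-square variables, and
  the characteristic functions of these converge along bounded sequences of arguments.\<close>

section \<open>Polya's theorem\<close>

text \<open>Monotonicity traps each \<open>F i\<close> between its values on a finite grid where
  \<open>cdf M\<close> takes the values \<open>j / K\<close>, and on a finite grid pointwise
  convergence is uniform. The assumptions on \<open>F i\<close> are only eventual because the law of
  the test statistic will be known to be a probability measure only for large
  \<open>n\<close>.\<close>

lemma (in real_distribution) uniform_limit_cdf:
  fixes F :: "'i \<Rightarrow> real \<Rightarrow> real"
  assumes atomless: "\<And>x. isCont (cdf M) x"
    and mono: "\<forall>\<^sub>F i in L. mono (F i)"
    and bounds: "\<forall>\<^sub>F i in L. \<forall>x. 0 \<le> F i x \<and> F i x \<le> 1"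
    and lim: "\<And>x. ((\<lambda>i. F i x) \<longlongrightarrow> cdf M x) L"
  shows "uniform_limit UNIV F (cdf M) L"
proof (rule uniform_limitI)
  fix e :: real
  assume "0 < e"
  obtain K :: nat where K: "3 / e < real K"
    using reals_Archimedean2 by blast
  have K0: "0 < real K"
    using K \<open>0 < e\<close> by (meson divide_pos_pos less_trans zero_less_numeral)
  have Ke: "3 / real K < e"
    using K K0 \<open>0 < e\<close> by (simp add: field_simps)
  have "\<exists>z. cdf M z = u" if u: "0 < u" "u < 1" for u
  proof -
    obtain a where a: "cdf M a < u"
      using eventually_happens'[OF _ order_tendstoD(2)[OF cdf_lim_at_bot u(1)]] by auto
    obtain b where b: "u < cdf M b"
      using eventually_happens'[OF _ order_tendstoD(1)[OF cdf_lim_at_top_prob u(2)]] by auto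
    have "a \<le> b"
      using a b cdf_nondecreasing[of b a] by linarith
    then show ?thesis
      using IVT'[of "cdf M" a u b] a b atomless
      by (auto intro!: continuous_at_imp_continuous_on)
  qed
  then have "\<exists>z. cdf M z = real j / real K" if "j \<in> {1..<K}" for j
    using that by auto
  then obtain z where z: "\<And>j. j \<in> {1..<K} \<Longrightarrow> cdf M (z j) = real j / real K"
    by metis
  have "\<forall>\<^sub>F i in L. \<forall>j\<in>{1..<K}. dist (F i (z j)) (cdf M (z j)) < 1 / real K"
    using K0 by (intro eventually_ball_finite ballI tendstoD[OF lim]) auto
  then show "\<forall>\<^sub>F i in L. \<forall>x\<in>UNIV. dist (F i x) (cdf M x) < e"
    using mono bounds
  proof eventually_elim
    case (elim i)
    \<comment> \<open>Scaling by \<open>K\<close> turns the grid levels into integers. The goal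
      becomes that \<open>g\<close> and \<open>h\<close> differ by less than 3, and \<open>K\<close>
      was chosen with \<open>3 / K < e\<close>.\<close>
    define g where "g t = real K * F i t" for t
    define h where "h t = real K * cdf M t" for t
    have g_mono: "g s \<le> g t" if "s < t" for s t
      using that K0 elim(2) by (simp add: g_def monoD)
    have less_if_h_less: "s < t" if "h s < h t" for s t
    proof (rule ccontr)
      assume "\<not> s < t"
      then have "h t \<le> h s"
        unfolding h_def using K0 by (intro mult_left_mono cdf_nondecreasing) auto
      with that show False
        by simp
    qed
    have g_bounds: "0 \<le> g t" "g t \<le> real K" for t
      using K0 elim(3) by (simp_all add: g_def)
    have h_bounds: "0 \<le> h t" "h t \<le> real K" for t
      using K0 cdf_bounded_prob[of t] by (simp_all add: h_def cdf_nonneg)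
    have h_z: "h (z j) = real j" if "j \<in> {1..<K}" for j
      using z[OF that] K0 by (simp add: h_def)
    have scaled_diff: "\<bar>g t - h t\<bar> = real K * dist (F i t) (cdf M t)" for t
      using K0 by (simp add: g_def h_def dist_real_def abs_mult flip: right_diff_distrib)
    have g_z: "\<bar>g (z j) - real j\<bar> < 1" if "j \<in> {1..<K}" for j
    proof -
      have "dist (F i (z j)) (cdf M (z j)) < 1 / real K"
        using elim(1) that by blast
      then have "real K * dist (F i (z j)) (cdf M (z j)) < 1"
        using K0 by (simp add: pos_less_divide_eq mult.commute)
      then show ?thesis
        using scaled_diff[of "z j"] h_z[OF that] by simp
    qed
    show ?case
    proof
      fix t
      \<comment> \<open>The point \<open>t\<close> is compared with the grid points numbered
        \<open>j + 1\<close> and \<open>j - 1\<close>. Number \<open>j\<close> does not serve on the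
        left: \<open>h t\<close> may equal \<open>j\<close>, and \<open>less_if_h_less\<close> needs
        a strict inequality. Each comparison costs a grid error below 1. Where a grid point is
        missing at either end, the bounds 0 and \<open>K\<close> of \<open>g\<close>
        suffice.\<close>
      define j where "j = nat \<lfloor>h t\<rfloor>"
      have j: "real j \<le> h t" "h t < real j + 1"
        using h_bounds(1)[of t] unfolding j_def by linarith+
      have upper: "g t < real j + 2"
      proof (cases "j + 1 < K")
        case True
        then have jK: "j + 1 \<in> {1..<K}"
          by simp
        have "t < z (j + 1)"
          by (rule less_if_h_less) (use j h_z[OF jK] in simp)
        from g_mono[OF this] g_z[OF jK] show ?thesis
          by simp
      next
        case False
        then show ?thesis
          using g_bounds(2)[of t] by linarith
      qed
      have lower: "real j - 2 < g t"
      proof (cases "2 \<le> j")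
        case True
        then have jK: "j - 1 \<in> {1..<K}" and j_pred: "real (j - 1) = real j - 1"
          using j(1) h_bounds(2)[of t] by (auto simp: of_nat_diff)
        have "z (j - 1) < t"
          by (rule less_if_h_less) (use j h_z[OF jK] j_pred in simp)
        from g_mono[OF this] g_z[OF jK] show ?thesis
          unfolding j_pred by linarith
      next
        case False
        then show ?thesis
          using g_bounds(1)[of t] by linarith
      qed
      have "\<bar>g t - h t\<bar> < 3"
        using upper lower j by linarith
      then have "dist (F i t) (cdf M t) < 3 / real K"
        using K0 by (simp add: scaled_diff pos_less_divide_eq mult.commute)
      then show "dist (F i t) (cdf M t) < e"
        using Ke by simp
    qed
  qed
qed

lemma uniform_limit_diff_tendsto_zero:
  fixes F :: "'i \<Rightarrow> 'a \<Rightarrow> 'b::real_normed_vector"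
  assumes "uniform_limit UNIV F G L"
  shows "((\<lambda>i. F i (x i) - G (x i)) \<longlongrightarrow> 0) L"
proof (rule tendstoI)
  fix e :: real
  assume "0 < e"
  from uniform_limitD[OF assms this] show "\<forall>\<^sub>F i in L. dist (F i (x i) - G (x i)) 0 < e"
    by eventually_elim (simp add: dist_norm)
qed

section \<open>The standard normal distribution function\<close>

interpretation std_normal: real_distribution std_normal_distribution
  by (rule real_dist_normal_dist)

lemma isCont_std_normal_cdf: "isCont std_normal_cdf x"
proof -
  have "AE t in lborel. t \<noteq> x"
    by (rule AE_lborel_singleton)
  then have "emeasure std_normal_distribution {x} = 0"
    by (subst AE_iff_measurable[symmetric, where P="\<lambda>t. t \<noteq> x"]) (auto simp: AE_density)
  then show ?thesis
    by (simp add: std_normal.isCont_cdf measure_def)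
qed

text \<open>A positive density gives every nondegenerate interval positive mass. Strictness is what
  makes normal quantiles stable under convergence of distribution functions.\<close>

lemma strict_mono_std_normal_cdf: "strict_mono std_normal_cdf"
proof (rule strict_monoI)
  fix a b :: real
  assume "a < b"
  have "emeasure std_normal_distribution {a<..b} \<noteq> 0"
  proof
    assume "emeasure std_normal_distribution {a<..b} = 0"
    then have "AE t in lborel. t \<notin> {a<..b}"
      by (subst (asm) AE_iff_measurable[symmetric, where P="\<lambda>t. t \<notin> {a<..b}"])
         (auto simp: AE_density normal_density_pos)
    then have "emeasure lborel {a<..b} = 0"
      by (subst AE_iff_measurable[symmetric, where P="\<lambda>t. t \<notin> {a<..b}"]) auto
    then show False
      using \<open>a < b\<close> by simp
  qed
  then have "0 < measure std_normal_distribution {a<..b}"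
    by (simp add: std_normal.emeasure_eq_measure zero_less_measure_iff)
  then show "std_normal_cdf a < std_normal_cdf b"
    using std_normal.cdf_diff_eq[OF \<open>a < b\<close>] by simp
qed

text \<open>Reflection at 0 preserves the law but turns \<open>{..- x}\<close> into
  \<open>{x..}\<close>, whose complement is the open half-line \<open>{..<x}\<close>; continuity at
  \<open>x\<close> closes it again.\<close>

lemma std_normal_cdf_minus: "std_normal_cdf (- x) = 1 - std_normal_cdf x"
proof -
  have "distributed std_normal_distribution lborel (\<lambda>t. 0 + (- 1) * t)
      (normal_density (0 + (- 1) * 0) (\<bar>- 1\<bar> * 1))"
    by (rule std_normal.normal_density_affine)
       (auto simp: distributed_def distr_id2 normal_density_nonneg)
  then have "distr std_normal_distribution lborel uminus = std_normal_distribution"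
    by (simp add: distributed_def)
  then have "measure std_normal_distribution {..- x} =
      measure (distr std_normal_distribution lborel uminus) {..- x}"
    by simp
  also have "\<dots> = measure std_normal_distribution {x..}"
    by (subst measure_distr) (auto intro!: arg_cong[where f="measure _"])
  also have "{x..} = UNIV - {..<x}"
    by auto
  also have "measure std_normal_distribution \<dots> = 1 - measure std_normal_distribution {..<x}"
    using std_normal.prob_compl[of "{..<x}"] by simp
  also have "measure std_normal_distribution {..<x} = std_normal_cdf x"
    using isCont_std_normal_cdf[of x] unfolding isCont_def filterlim_at_split
    by (blast intro: tendsto_unique[OF trivial_limit_at_left_real std_normal.cdf_at_left])
  finally show ?thesis
    by (simp add: cdf_def)
qed

text \<open>The normal quantile is written with \<open>inv_into\<close>, which inverts only on the
  range; by the intermediate value theorem the range contains every level strictly between 0 and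
  1.\<close>

lemma std_normal_cdf_inv_into:
  assumes "0 < u" "u < 1"
  shows "std_normal_cdf (inv_into UNIV std_normal_cdf u) = u"
proof -
  obtain a where a: "std_normal_cdf a < u"
    using eventually_happens'[OF _ order_tendstoD(2)[OF std_normal.cdf_lim_at_bot assms(1)]] by auto
  obtain b where b: "u < std_normal_cdf b"
    using eventually_happens'[OF _ order_tendstoD(1)[OF std_normal.cdf_lim_at_top_prob assms(2)]]
    by auto
  have "a \<le> b"
    using a b std_normal.cdf_nondecreasing[of b a] by linarith
  then have "u \<in> range std_normal_cdf"
    using IVT'[of std_normal_cdf a u b] a b
    by (auto intro!: continuous_at_imp_continuous_on isCont_std_normal_cdf)
  then show ?thesis
    by (rule f_inv_into_f)
qed

section \<open>Measurability from a nonzero image measure\<close>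

text \<open>For non-measurable \<open>f\<close>, \<open>distr M N f\<close> is the null measure: the set function it is built from
  would vanish on some set and on its complement, hence is not additive. Thus the weak convergence
  hypothesis already contains the measurability of the test statistic.\<close>

lemma (in prob_space) measurable_if_distr_nonzero:
  assumes f: "f \<in> space M \<rightarrow> space N"
    and A: "emeasure (distr M N f) A \<noteq> 0"
  shows "f \<in> measurable M N"
proof (rule measurableI)
  fix x assume "x \<in> space M" then show "f x \<in> space N"
    using f by auto
next
  fix B
  assume B: "B \<in> sets N"
  let ?\<mu> = "\<lambda>B. emeasure M (f -` B \<inter> space M)"
  have ms: "measure_space (space N) (sigma_sets (space N) (sets N)) ?\<mu>"
    using A unfolding distr_def emeasure_measure_of_conv by (meson)
  have eq: "emeasure (distr M N f) C = ?\<mu> C" if "C \<in> sets N" for C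
    using ms that sets.sigma_sets_eq[of N] unfolding distr_def emeasure_measure_of_conv
    by simp
  have "emeasure (distr M N f) (space N) = 1"
  proof -
    have "f -` space N \<inter> space M = space M"
      using f by auto
    then show ?thesis
      by (simp add: eq emeasure_space_1)
  qed
  moreover have "emeasure (distr M N f) (space N) =
      emeasure (distr M N f) B + emeasure (distr M N f) (space N - B)"
    using B sets.sets_into_space[OF B] by (subst plus_emeasure) (auto intro!: arg_cong[where f="emeasure _"])
  ultimately have sum: "?\<mu> B + ?\<mu> (space N - B) = 1"
    using B by (simp add: eq)
  show "f -` B \<inter> space M \<in> sets M"
  proof (rule ccontr)
    assume *: "f -` B \<inter> space M \<notin> sets M"
    have "f -` B \<inter> space M = space M - (f -` (space N - B) \<inter> space M)"
      using f by auto
    then have "f -` (space N - B) \<inter> space M \<notin> sets M"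
      using * by (metis sets.compl_sets)
    with * sum show False
      by (simp add: emeasure_notin_sets)
  qed
qed

section \<open>Characteristic functions at moving arguments\<close>

lemma tendsto_zero_mult_Bseq:
  fixes f g :: "nat \<Rightarrow> 'a::real_normed_algebra"
  assumes "f \<longlonglongrightarrow> 0" "Bseq g"
  shows "(\<lambda>n. f n * g n) \<longlonglongrightarrow> 0"
  using bounded_bilinear.Zfun_prod_Bfun[OF bounded_bilinear_mult, of f sequentially g] assms
  by (simp add: tendsto_Zfun_iff)

text \<open>Skorohod's representation makes the convergence pointwise. Then
  \<open>u n * (Z (k n) - Z0)\<close> tends to 0 for any bounded \<open>u\<close> and any index
  sequence \<open>k\<close> tending to infinity, even if \<open>u\<close> does not converge, and
  dominated convergence finishes.\<close>

lemma tendsto_char_diff_zero: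
  fixes \<mu> :: "nat \<Rightarrow> real measure" and k :: "nat \<Rightarrow> nat"
  assumes \<mu>: "\<And>n. real_distribution (\<mu> n)" and M: "real_distribution M"
    and lim: "weak_conv_m \<mu> M"
    and k: "filterlim k at_top sequentially"
    and u: "Bseq u"
  shows "(\<lambda>n. char (\<mu> (k n)) (u n) - char M (u n)) \<longlonglongrightarrow> 0"
proof -
  obtain \<Omega> :: "real measure" and Z Z0 where \<Omega>: "prob_space \<Omega>"
    and Z [measurable]: "\<And>n. Z n \<in> borel_measurable \<Omega>"
    and Z_distr: "\<And>n. distr \<Omega> borel (Z n) = \<mu> n"
    and Z0: "Z0 \<in> measurable \<Omega> lborel" and Z0_distr: "distr \<Omega> borel Z0 = M"
    and Z_lim: "\<And>\<omega>. \<omega> \<in> space \<Omega> \<Longrightarrow> (\<lambda>n. Z n \<omega>) \<longlonglongrightarrow> Z0 \<omega>"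
    using Skorohod[OF \<mu> M lim] by metis
  have [measurable]: "Z0 \<in> borel_measurable \<Omega>"
    using Z0 by simp
  interpret prob_space \<Omega>
    by (rule \<Omega>)
  have int: "integrable \<Omega> (\<lambda>\<omega>. iexp (c * Z n \<omega>))" "integrable \<Omega> (\<lambda>\<omega>. iexp (c * Z0 \<omega>))" for c n
    by (auto intro!: integrable_const_bound[where B=1])
  have eq: "char (\<mu> (k n)) (u n) - char M (u n) =
      (\<integral>\<omega>. iexp (u n * Z (k n) \<omega>) - iexp (u n * Z0 \<omega>) \<partial>\<Omega>)" for n
    by (subst Bochner_Integration.integral_diff[OF int])
       (simp add: char_def integral_distr flip: Z_distr Z0_distr)
  have "(\<lambda>n. \<integral>\<omega>. iexp (u n * Z (k n) \<omega>) - iexp (u n * Z0 \<omega>) \<partial>\<Omega>) \<longlonglongrightarrow> (\<integral>\<omega>. 0 \<partial>\<Omega>)"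
  proof (rule integral_dominated_convergence[where w="\<lambda>_. 2"])
    show "AE \<omega> in \<Omega>. (\<lambda>n. iexp (u n * Z (k n) \<omega>) - iexp (u n * Z0 \<omega>)) \<longlonglongrightarrow> 0"
    proof (rule AE_I2)
      fix \<omega>
      assume "\<omega> \<in> space \<Omega>"
      then have "(\<lambda>n. Z (k n) \<omega> - Z0 \<omega>) \<longlonglongrightarrow> 0"
        using filterlim_compose[OF Z_lim k] by (simp add: LIM_zero_iff)
      from tendsto_zero_mult_Bseq[OF this u] have "(\<lambda>n. u n * (Z (k n) \<omega> - Z0 \<omega>)) \<longlonglongrightarrow> 0"
        by (simp add: mult.commute)
      then have "(\<lambda>n. iexp (u n * (Z (k n) \<omega> - Z0 \<omega>)) - 1) \<longlonglongrightarrow> iexp 0 - 1"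
        by (intro tendsto_diff tendsto_const isCont_tendsto_compose[OF isCont_iexp])
      then have "(\<lambda>n. norm (iexp (u n * (Z (k n) \<omega> - Z0 \<omega>)) - 1)) \<longlonglongrightarrow> 0"
        using tendsto_norm by fastforce
      \<comment> \<open>The two exponentials share a factor of modulus 1, so only the difference
        \<open>b - c\<close> matters.\<close>
      moreover have shift: "norm (iexp (a * b) - iexp (a * c)) = norm (iexp (a * (b - c)) - 1)"
        for a b c :: real
      proof -
        have "iexp (a * b) - iexp (a * c) = iexp (a * c) * (iexp (a * (b - c)) - 1)"
          by (simp add: algebra_simps flip: exp_add)
        then show ?thesis
          by (simp only: norm_mult norm_exp_i_times)
      qed
      ultimately show "(\<lambda>n. iexp (u n * Z (k n) \<omega>) - iexp (u n * Z0 \<omega>)) \<longlonglongrightarrow> 0"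
        by (subst tendsto_norm_zero_iff[symmetric]) (simp only: shift)
    qed
    show "AE \<omega> in \<Omega>. norm (iexp (u n * Z (k n) \<omega>) - iexp (u n * Z0 \<omega>)) \<le> 2" for n
      by (intro AE_I2 norm_triangle_le_diff) (simp del: of_real_mult)
  qed auto
  then show ?thesis
    by (simp add: eq)
qed

section \<open>Chi-square distributions\<close>

lemma prob_space_chi_square: "prob_space (chi_square_distribution k)"
  unfolding chi_square_distribution_def
  by (intro prob_space.prob_space_distr prob_space_PiM std_normal.prob_space_axioms) measurable

lemma sets_chi_square [simp, measurable_cong]: "sets (chi_square_distribution k) = sets borel"
  by (simp add: chi_square_distribution_def)

text \<open>A single coordinate that is almost surely nonzero suffices, and \<open>0 < k\<close>
  provides coordinate 0. This permits clearing the denominator of an F-distributed variable.\<close>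

lemma AE_chi_square_pos:
  assumes "0 < k"
  shows "AE a in chi_square_distribution k. 0 < a"
proof -
  have "AE t in std_normal_distribution. t \<noteq> 0"
    using AE_lborel_singleton[of "0 :: real"] by (auto simp: AE_density)
  then have "AE z in Pi\<^sub>M {..<k} (\<lambda>_. std_normal_distribution). z 0 \<noteq> 0"
    using assms by (intro AE_PiM_component std_normal.prob_space_axioms) auto
  then have "AE z in Pi\<^sub>M {..<k} (\<lambda>_. std_normal_distribution). 0 < (\<Sum>i<k. (z i)\<^sup>2)"
  proof eventually_elim
    case (elim z)
    then show ?case
      using assms by (intro sum_pos2[of _ 0]) auto
  qed
  then show ?thesis
    unfolding chi_square_distribution_def by (subst AE_distr_iff) auto
qed

text \<open>The classical central limit theorem for squares of independent standard normal
  variables. It asks for one probability space serving all \<open>k\<close>, hence the infinite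
  product.\<close>

lemma chi_square_clt:
  "weak_conv_m
    (\<lambda>k. distr (chi_square_distribution k) borel (\<lambda>a. (a - real k) / sqrt (2 * real k)))
    std_normal_distribution"
proof -
  let ?P = "Pi\<^sub>M UNIV (\<lambda>_::nat. std_normal_distribution)"
  interpret P: product_prob_space "\<lambda>_::nat. std_normal_distribution" UNIV
    by standard
  have comp: "distr ?P borel (\<lambda>\<omega>. \<omega> i) = std_normal_distribution" for i
  proof -
    have "distr ?P borel (\<lambda>\<omega>. \<omega> i) = distr ?P std_normal_distribution (\<lambda>\<omega>. \<omega> i)"
      by (rule distr_cong) simp_all
    then show ?thesis
      using P.PiM_component[of i] by simp
  qed
  have "P.indep_vars (\<lambda>_. borel) (\<lambda>i \<omega>. \<omega> i) UNIV"
    by (subst P.indep_vars_iff_distr_eq_PiM') (auto simp: comp restrict_def intro!: distr_id2 sets_PiM_cong)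
  then have indep: "P.indep_vars (\<lambda>_. borel) (\<lambda>i \<omega>. (\<omega> i)\<^sup>2) UNIV"
    by (rule P.indep_vars_compose2) simp
  have m2: "integrable std_normal_distribution (\<lambda>x. x\<^sup>2)"
    "(\<integral>x. x\<^sup>2 \<partial>std_normal_distribution) = 1"
    using std_normal_distribution_even_moments[of 1] by simp_all
  have m4: "integrable std_normal_distribution (\<lambda>x. x ^ 4)"
    "(\<integral>x. x ^ 4 \<partial>std_normal_distribution) = 3"
    using std_normal_distribution_even_moments[of 2] by (simp_all add: fact_numeral)
  have trans: "(\<integral>\<omega>. f (\<omega> i) \<partial>?P) = (\<integral>x. f x \<partial>std_normal_distribution)"
    if "f \<in> borel_measurable borel" for f :: "real \<Rightarrow> real" and i
  proof -
    have "(\<integral>x. f x \<partial>distr ?P borel (\<lambda>\<omega>. \<omega> i)) = (\<integral>\<omega>. f (\<omega> i) \<partial>?P)"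
      by (rule integral_distr) (simp_all add: that)
    then show ?thesis
      by (simp only: comp)
  qed
  have "weak_conv_m
      (\<lambda>k. distr ?P borel (\<lambda>\<omega>. (\<Sum>i<k. (\<omega> i)\<^sup>2 - 1) / sqrt (real k * (sqrt 2)\<^sup>2)))
      std_normal_distribution"
  proof (rule P.central_limit_theorem[where X="\<lambda>i \<omega>. (\<omega> i)\<^sup>2"
        and \<mu>="distr std_normal_distribution borel (\<lambda>x. x\<^sup>2)"])
    show "P.indep_vars (\<lambda>i. borel) (\<lambda>i \<omega>. (\<omega> i)\<^sup>2) UNIV"
      by (rule indep)
    show mean: "P.expectation (\<lambda>\<omega>. (\<omega> i)\<^sup>2) = 1" for i
      using trans[of "\<lambda>x. x\<^sup>2" i] m2 by simp
    show "0 < sqrt (2 :: real)"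
      by simp
    show "integrable ?P (\<lambda>\<omega>. ((\<omega> i)\<^sup>2)\<^sup>2)" for i
    proof -
      have "integrable (distr ?P borel (\<lambda>\<omega>. \<omega> i)) (\<lambda>x. (x\<^sup>2)\<^sup>2)"
        using m4(1) by (simp add: comp flip: power_mult)
      then show ?thesis
        by (rule integrable_distr[rotated]) simp
    qed
    \<comment> \<open>The variance of a squared standard normal variable, from the moments 1 and 3:
      \<open>3 - 2 * 1 + 1 = 2\<close>.\<close>
    have "(\<integral>x. (x\<^sup>2 - 1)\<^sup>2 \<partial>std_normal_distribution) =
        (\<integral>x. x ^ 4 - 2 * x\<^sup>2 + 1 \<partial>std_normal_distribution)"
      by (intro Bochner_Integration.integral_cong) (auto simp: power2_eq_square power4_eq_xxxx algebra_simps)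
    also have "\<dots> = 2"
      using m2 m4 std_normal.prob_space by simp
    finally show "P.variance (\<lambda>\<omega>. (\<omega> i)\<^sup>2) = (sqrt 2)\<^sup>2" for i
      using trans[of "\<lambda>x. (x\<^sup>2 - 1)\<^sup>2" i] by (simp add: mean)
    show "distr ?P borel (\<lambda>\<omega>. (\<omega> i)\<^sup>2) = distr std_normal_distribution borel (\<lambda>x. x\<^sup>2)" for i
    proof -
      have "distr ?P borel (\<lambda>\<omega>. (\<omega> i)\<^sup>2) = distr (distr ?P borel (\<lambda>\<omega>. \<omega> i)) borel (\<lambda>x. x\<^sup>2)"
        by (subst distr_distr) (simp_all add: comp_def)
      then show ?thesis
        by (simp only: comp)
    qed
  qed
  \<comment> \<open>Projection to the first \<open>k\<close> coordinates turns the infinite product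
    into the finite one behind \<open>chi_square_distribution k\<close>.\<close>
  moreover have "distr ?P borel (\<lambda>\<omega>. (\<Sum>i<k. (\<omega> i)\<^sup>2 - 1) / sqrt (real k * (sqrt 2)\<^sup>2)) =
      distr (chi_square_distribution k) borel (\<lambda>a. (a - real k) / sqrt (2 * real k))" for k
  proof -
    have "chi_square_distribution k =
        distr (distr ?P (Pi\<^sub>M {..<k} (\<lambda>_. std_normal_distribution)) (\<lambda>\<omega>. restrict \<omega> {..<k})) borel
          (\<lambda>z. \<Sum>i<k. (z i)\<^sup>2)"
      unfolding chi_square_distribution_def
      by (subst P.distr_PiM_restrict_finite) auto
    also have "\<dots> = distr ?P borel (\<lambda>\<omega>. \<Sum>i<k. (\<omega> i)\<^sup>2)"
      by (subst distr_distr) (auto simp: comp_def intro!: measurable_restrict_subset)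
    finally show ?thesis
      by (auto simp: distr_distr comp_def sum_subtractf mult.commute intro!: distr_cong)
  qed
  ultimately show ?thesis
    by simp
qed

section \<open>Central limit theorem for the F-distribution\<close>

lemma prob_space_F_distribution: "prob_space (F_distribution q m)"
proof -
  interpret chi_q: prob_space "chi_square_distribution q"
    by (rule prob_space_chi_square)
  interpret chi_m: prob_space "chi_square_distribution m"
    by (rule prob_space_chi_square)
  interpret pair_prob_space "chi_square_distribution q" "chi_square_distribution m" ..
  show ?thesis
    unfolding F_distribution_def by (intro prob_space_distr) measurable
qed

lemma real_distribution_F: "real_distribution (F_distribution q m)"
  by (intro real_distribution.intro prob_space_F_distribution)
     (simp add: real_distribution_axioms_def F_distribution_def)

text \<open>With \<open>X\<close> and \<open>Y\<close> the standardized numerator and denominator, clearing the denominator in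
  \<open>(a / q) / (b / m) \<le> 1 + sqrt s * t\<close> leaves a linear inequality in \<open>X\<close> and \<open>Y\<close>.\<close>

lemma cdf_F_distribution:
  fixes t :: real
  assumes q: "0 < q" and m: "0 < m"
  defines "s \<equiv> 2 * (1 / real q + 1 / real m)"
  shows "cdf (F_distribution q m) (1 + sqrt s * t) =
    cdf (distr (chi_square_distribution q \<Otimes>\<^sub>M chi_square_distribution m) borel
      (\<lambda>(a, b). sqrt (2 / real q / s) * ((a - real q) / sqrt (2 * real q))
        + - sqrt (2 / real m / s) * (1 + sqrt s * t) * ((b - real m) / sqrt (2 * real m)))) t"
proof -
  interpret chi_q: prob_space "chi_square_distribution q"
    by (rule prob_space_chi_square)
  interpret chi_m: prob_space "chi_square_distribution m"
    by (rule prob_space_chi_square)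
  interpret N: pair_prob_space "chi_square_distribution q" "chi_square_distribution m" ..
  let ?N = "chi_square_distribution q \<Otimes>\<^sub>M chi_square_distribution m"
  let ?V = "\<lambda>a b. sqrt (2 / real q / s) * ((a - real q) / sqrt (2 * real q))
        + - sqrt (2 / real m / s) * (1 + sqrt s * t) * ((b - real m) / sqrt (2 * real m))"
  have "s > 0"
    using q m by (simp add: s_def add_pos_pos)
  \<comment> \<open>A chi-square variable divided by its \<open>k\<close> degrees of freedom has
    variance \<open>2 / k\<close>, so the weight is the ratio of its standard deviation to
    \<open>sqrt s\<close>.\<close>
  have standardize: "sqrt (2 / real k / s) * ((c - real k) / sqrt (2 * real k)) =
      (c / real k - 1) / sqrt s" if "0 < k" for k c
    using that \<open>s > 0\<close>
    by (simp add: real_sqrt_divide real_sqrt_mult divide_simps)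
  have iff: "(a / real q) / (b / real m) \<le> 1 + sqrt s * t \<longleftrightarrow> ?V a b \<le> t" if "0 < b" for a b
  proof -
    have "?V a b = sqrt (2 / real q / s) * ((a - real q) / sqrt (2 * real q))
        - (1 + sqrt s * t) * (sqrt (2 / real m / s) * ((b - real m) / sqrt (2 * real m)))"
      by (simp only: mult_minus_left mult.left_commute mult.assoc diff_conv_add_uminus)
    also have "\<dots> = (a / real q - 1) / sqrt s - (1 + sqrt s * t) * ((b / real m - 1) / sqrt s)"
      by (simp only: standardize[OF q] standardize[OF m])
    also have "\<dots> \<le> t \<longleftrightarrow> a / real q - 1 - (1 + sqrt s * t) * (b / real m - 1) \<le> sqrt s * t"
      using \<open>s > 0\<close> by (simp add: diff_divide_distrib[symmetric] pos_divide_le_eq mult.commute)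
    also have "\<dots> \<longleftrightarrow> a / real q \<le> (1 + sqrt s * t) * (b / real m)"
      by (simp add: algebra_simps)
    also have "\<dots> \<longleftrightarrow> (a / real q) / (b / real m) \<le> 1 + sqrt s * t"
      using that m by (subst pos_divide_le_eq) simp_all
    finally show ?thesis
      by simp
  qed
  \<comment> \<open>Since \<open>iff\<close> is available only for a positive denominator, the two
    events are compared up to a null set.\<close>
  have "AE ab in ?N. 0 < snd ab"
  proof (rule N.AE_pair_measure)
    show "{ab \<in> space ?N. 0 < snd ab} \<in> sets ?N"
      by measurable
    show "AE a in chi_square_distribution q. AE b in chi_square_distribution m. 0 < snd (a, b)"
      using AE_chi_square_pos[OF m] by simp
  qed
  then have "AE ab in ?N.
      ab \<in> {ab \<in> space ?N. (fst ab / real q) / (snd ab / real m) \<le> 1 + sqrt s * t} \<longleftrightarrow>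
      ab \<in> {ab \<in> space ?N. ?V (fst ab) (snd ab) \<le> t}"
    by eventually_elim (simp only: mem_Collect_eq iff)
  then have "measure ?N {ab \<in> space ?N. (fst ab / real q) / (snd ab / real m) \<le> 1 + sqrt s * t} =
      measure ?N {ab \<in> space ?N. ?V (fst ab) (snd ab) \<le> t}"
    by (rule measure_eq_AE) measurable
  then show ?thesis
    unfolding cdf_def F_distribution_def
    by (simp add: measure_distr split_beta' vimage_def Int_def conj_commute)
qed

text \<open>The coordinates are independent under the product measure: the exponential splits, and
  Fubini's theorem separates the factors.\<close>

lemma char_pair_combination:
  fixes w \<kappa> u :: real and f g :: "real \<Rightarrow> real"
  assumes P: "prob_space P" and Q: "prob_space Q"
    and [measurable]: "f \<in> borel_measurable P" "g \<in> borel_measurable Q"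
  shows "char (distr (P \<Otimes>\<^sub>M Q) borel (\<lambda>(a, b). w * f a + \<kappa> * g b)) u =
    char (distr P borel f) (w * u) * char (distr Q borel g) (\<kappa> * u)"
proof -
  interpret P: prob_space P by (rule P)
  interpret Q: prob_space Q by (rule Q)
  interpret N: pair_prob_space P Q ..
  have "char (distr (P \<Otimes>\<^sub>M Q) borel (\<lambda>(a, b). w * f a + \<kappa> * g b)) u =
      (\<integral>x. iexp ((w * u) * f (fst x)) * iexp ((\<kappa> * u) * g (snd x)) \<partial>(P \<Otimes>\<^sub>M Q))"
    by (simp add: char_def integral_distr split_beta' algebra_simps exp_add)
  also have "\<dots> = (\<integral>a. (\<integral>b. iexp ((w * u) * f a) * iexp ((\<kappa> * u) * g b) \<partial>Q) \<partial>P)"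
    by (subst N.integral_fst'[symmetric])
       (auto intro!: N.integrable_const_bound[where B=1] simp: norm_mult simp del: of_real_mult)
  also have "\<dots> = char (distr P borel f) (w * u) * char (distr Q borel g) (\<kappa> * u)"
    by (simp add: char_def integral_distr)
  finally show ?thesis .
qed

text \<open>The weights \<open>w\<close> and \<open>w'\<close> need not converge, as nothing relates
  \<open>q\<close> to \<open>m\<close>. So each characteristic function is compared with the
  Gaussian one at the same moving argument, and only the product of the Gaussian factors, which
  depends on \<open>w\<close> and \<open>\<kappa>\<close> through the sum of their squares, has to
  converge.\<close>

lemma F_distribution_clt:
  fixes q m :: "nat \<Rightarrow> nat"
  assumes q: "filterlim q at_top sequentially" and m: "filterlim m at_top sequentially"
  defines "s n \<equiv> 2 * (1 / real (q n) + 1 / real (m n))"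
  shows "(\<lambda>n. cdf (F_distribution (q n) (m n)) (1 + sqrt (s n) * t)) \<longlonglongrightarrow> std_normal_cdf t"
proof -
  define w where "w n = sqrt (2 / real (q n) / s n)" for n
  define w' where "w' n = sqrt (2 / real (m n) / s n)" for n
  \<comment> \<open>This coefficient contains \<open>t\<close>, so \<open>V n\<close> does too: its
    weak convergence is proved for the fixed \<open>t\<close> and then used at that same
    \<open>t\<close> only.\<close>
  define \<kappa> where "\<kappa> n = - w' n * (1 + sqrt (s n) * t)" for n
  define \<mu> where
    "\<mu> = (\<lambda>k. distr (chi_square_distribution k) borel (\<lambda>a. (a - real k) / sqrt (2 * real k)))"
  define V where "V n = distr (chi_square_distribution (q n) \<Otimes>\<^sub>M chi_square_distribution (m n)) borel
      (\<lambda>(a, b). w n * ((a - real (q n)) / sqrt (2 * real (q n)))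
        + \<kappa> n * ((b - real (m n)) / sqrt (2 * real (m n))))" for n
  have pos: "\<forall>\<^sub>F n in sequentially. 0 < q n \<and> 0 < m n"
    using q[unfolded filterlim_at_top, rule_format, of 1] m[unfolded filterlim_at_top, rule_format, of 1]
    by eventually_elim simp
  have inverse_real: "(\<lambda>n. 1 / real (k n)) \<longlonglongrightarrow> 0" if "filterlim k at_top sequentially" for k
    using filterlim_compose[OF lim_1_over_n that] .
  have "s \<longlonglongrightarrow> 2 * (0 + 0)"
    unfolding s_def by (intro tendsto_intros inverse_real q m)
  then have s_lim: "s \<longlonglongrightarrow> 0"
    by simp
  have weights: "\<forall>\<^sub>F n in sequentially. (w n)\<^sup>2 + (w' n)\<^sup>2 = 1"
    using pos
  proof eventually_elim
    case (elim n)
    then have "0 < s n"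
      by (simp add: s_def add_pos_pos)
    then have "(w n)\<^sup>2 = 2 / real (q n) / s n" "(w' n)\<^sup>2 = 2 / real (m n) / s n"
      by (simp_all add: w_def w'_def)
    then have "(w n)\<^sup>2 + (w' n)\<^sup>2 = (2 / real (q n) + 2 / real (m n)) / s n"
      by (simp only: add_divide_distrib)
    also have "2 / real (q n) + 2 / real (m n) = s n"
      by (simp add: s_def)
    finally show ?case
      using \<open>0 < s n\<close> by simp
  qed
  have bounded: "\<forall>\<^sub>F n in sequentially. \<bar>w n\<bar> \<le> 1 \<and> \<bar>w' n\<bar> \<le> 1"
    using weights
  proof eventually_elim
    case (elim n)
    then have "(w n)\<^sup>2 \<le> 1" "(w' n)\<^sup>2 \<le> 1"
      using zero_le_power2[of "w n"] zero_le_power2[of "w' n"] by linarith+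
    then show ?case
      by (simp add: abs_square_le_1)
  qed
  then have Bseq: "Bseq w" "Bseq w'"
    by (auto simp: eventually_conj_iff intro!: BfunI[where K=1])
  have "(\<lambda>n. 1 + sqrt (s n) * t) \<longlonglongrightarrow> 1 + sqrt 0 * t"
    by (intro tendsto_intros s_lim)
  then have factor: "(\<lambda>n. 1 + sqrt (s n) * t) \<longlonglongrightarrow> 1"
    by simp
  then have "Bseq (\<lambda>n. 1 + sqrt (s n) * t)"
    by (intro convergent_imp_Bseq convergentI)
  with Bseq(2) have "Bseq (\<lambda>n. w' n * (1 + sqrt (s n) * t))"
    by (rule Bseq_mult)
  then have "Bseq \<kappa>"
    using Bseq_minus_iff[of "\<lambda>n. w' n * (1 + sqrt (s n) * t)"] by (simp add: \<kappa>_def[abs_def])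
  have \<mu>_real: "real_distribution (\<mu> k)" for k
    unfolding \<mu>_def
    by (intro prob_space.real_distribution_distr prob_space_chi_square) measurable
  have char_\<mu>: "(\<lambda>n. char (\<mu> (k n)) (c n * u) - complex_of_real (exp (- (c n * u)\<^sup>2 / 2))) \<longlonglongrightarrow> 0"
    if "filterlim k at_top sequentially" "Bseq c" for k c u
  proof -
    have "Bseq (\<lambda>n. c n * u)"
      using that(2) by (intro Bseq_mult) (auto intro: convergent_imp_Bseq)
    moreover have "weak_conv_m \<mu> std_normal_distribution"
      unfolding \<mu>_def by (rule chi_square_clt)
    ultimately show ?thesis
      using tendsto_char_diff_zero[OF \<mu>_real real_dist_normal_dist _ that(1)]
      by (simp add: char_std_normal_distribution)
  qed
  have "weak_conv_m V std_normal_distribution"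
  proof (rule levy_continuity)
    show "real_distribution (V n)" for n
    proof -
      interpret chi_q: prob_space "chi_square_distribution (q n)"
        by (rule prob_space_chi_square)
      interpret chi_m: prob_space "chi_square_distribution (m n)"
        by (rule prob_space_chi_square)
      interpret pair_prob_space "chi_square_distribution (q n)" "chi_square_distribution (m n)" ..
      show ?thesis
        unfolding V_def by (intro real_distribution_distr) measurable
    qed
    show "real_distribution std_normal_distribution"
      by (rule real_dist_normal_dist)
    fix u
    let ?A = "\<lambda>n. char (\<mu> (q n)) (w n * u)" and ?B = "\<lambda>n. char (\<mu> (m n)) (\<kappa> n * u)"
    let ?a = "\<lambda>n. complex_of_real (exp (- (w n * u)\<^sup>2 / 2))"
    let ?b = "\<lambda>n. complex_of_real (exp (- (\<kappa> n * u)\<^sup>2 / 2))"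
    have char_V: "char (V n) u = ?A n * ?B n" for n
      unfolding V_def \<mu>_def by (intro char_pair_combination prob_space_chi_square) measurable
    have "Bseq ?B"
      by (intro BseqI'[where K=1] real_distribution.cmod_char_le_1 \<mu>_real)
    moreover have "Bseq ?a"
      by (intro BseqI'[where K=1]) simp
    \<comment> \<open>The telescoping identity
      \<open>A * B - a * b = (A - a) * B + (B - b) * a\<close>, with bounded cofactors.\<close>
    ultimately have "(\<lambda>n. (?A n - ?a n) * ?B n + (?B n - ?b n) * ?a n) \<longlonglongrightarrow> 0 + 0"
      by (intro tendsto_add tendsto_zero_mult_Bseq char_\<mu> q m Bseq \<open>Bseq \<kappa>\<close>)
    then have "(\<lambda>n. char (V n) u - ?a n * ?b n) \<longlonglongrightarrow> 0"
      by (simp add: char_V algebra_simps)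
    moreover have "(\<lambda>n. ?a n * ?b n) \<longlonglongrightarrow> char std_normal_distribution u"
    proof -
      \<comment> \<open>As the squares of \<open>w n\<close> and \<open>w' n\<close> eventually add
        up to 1, this null sequence is what replacing \<open>w' n\<close> by
        \<open>\<kappa> n\<close> adds to their sum.\<close>
      have "(\<lambda>n. ((1 + sqrt (s n) * t)\<^sup>2 - 1) * (w' n)\<^sup>2) \<longlonglongrightarrow> 0"
      proof (rule tendsto_zero_mult_Bseq)
        have "(\<lambda>n. (1 + sqrt (s n) * t)\<^sup>2 - 1) \<longlonglongrightarrow> 1\<^sup>2 - 1"
          by (intro tendsto_intros factor)
        then show "(\<lambda>n. (1 + sqrt (s n) * t)\<^sup>2 - 1) \<longlonglongrightarrow> 0"
          by simp
        show "Bseq (\<lambda>n. (w' n)\<^sup>2)"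
          using Bseq_mult[OF Bseq(2) Bseq(2)] by (simp add: power2_eq_square)
      qed
      then have "(\<lambda>n. 1 + ((1 + sqrt (s n) * t)\<^sup>2 - 1) * (w' n)\<^sup>2) \<longlonglongrightarrow> 1 + 0"
        by (intro tendsto_intros)
      moreover have "\<forall>\<^sub>F n in sequentially.
          1 + ((1 + sqrt (s n) * t)\<^sup>2 - 1) * (w' n)\<^sup>2 = (w n)\<^sup>2 + (\<kappa> n)\<^sup>2"
        using weights
      proof eventually_elim
        case (elim n)
        have "(\<kappa> n)\<^sup>2 = (1 + sqrt (s n) * t)\<^sup>2 * (w' n)\<^sup>2"
          by (simp add: \<kappa>_def power_mult_distrib mult.commute)
        with elim show ?case
          by (simp add: left_diff_distrib)
      qed
      ultimately have "(\<lambda>n. (w n)\<^sup>2 + (\<kappa> n)\<^sup>2) \<longlonglongrightarrow> 1"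
        by (simp add: tendsto_cong)
      then have "(\<lambda>n. complex_of_real (exp (- (((w n)\<^sup>2 + (\<kappa> n)\<^sup>2) * u\<^sup>2) / 2))) \<longlonglongrightarrow>
          complex_of_real (exp (- (1 * u\<^sup>2) / 2))"
        by (intro tendsto_intros) auto
      moreover have "?a n * ?b n = complex_of_real (exp (- (((w n)\<^sup>2 + (\<kappa> n)\<^sup>2) * u\<^sup>2) / 2))" for n
      proof -
        have "- (((w n)\<^sup>2 + (\<kappa> n)\<^sup>2) * u\<^sup>2) / 2 = - (w n * u)\<^sup>2 / 2 + - (\<kappa> n * u)\<^sup>2 / 2"
          by (simp add: power_mult_distrib field_simps)
        then show ?thesis
          by (simp only: exp_add of_real_mult)
      qed
      ultimately show ?thesis
        by (simp add: char_std_normal_distribution)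
    qed
    ultimately show "(\<lambda>n. char (V n) u) \<longlonglongrightarrow> char std_normal_distribution u"
      by (rule Lim_transform[rotated])
  qed
  then have "(\<lambda>n. cdf (V n) t) \<longlonglongrightarrow> std_normal_cdf t"
    by (simp add: weak_conv_m_def weak_conv_def isCont_std_normal_cdf)
  moreover have "\<forall>\<^sub>F n in sequentially.
      cdf (V n) t = cdf (F_distribution (q n) (m n)) (1 + sqrt (s n) * t)"
    using pos
  proof eventually_elim
    case (elim n)
    then have "0 < q n" "0 < m n"
      by simp_all
    from cdf_F_distribution[OF this, of t] show ?case
      by (simp only: V_def w_def w'_def \<kappa>_def s_def)
  qed
  ultimately show ?thesis
    by (rule Lim_transform_eventually)
qed

section \<open>Convergence of quantiles\<close>

text \<open>Strict monotonicity puts \<open>u\<close> strictly between the values of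
  \<open>G\<close> at \<open>z - e / 2\<close> and \<open>z + e / 2\<close>. The distribution
  functions eventually separate \<open>u\<close> in the same way, which squeezes the
  quantile.\<close>

lemma tendsto_normalized_quantile:
  fixes a c :: "'i \<Rightarrow> real"
  assumes G: "strict_mono G" "G z = u"
    and lim: "\<And>t. ((\<lambda>i. cdf (D i) (a i + c i * t)) \<longlongrightarrow> G t) L"
    and D: "\<And>i. real_distribution (D i)"
    and c: "\<forall>\<^sub>F i in L. 0 < c i"
  shows "((\<lambda>i. (quantile (D i) u - a i) / c i) \<longlongrightarrow> z) L"
proof (rule tendstoI)
  fix e :: real
  assume "0 < e"
  have "G (z - e / 2) < u" "u < G (z + e / 2)"
    using \<open>0 < e\<close> G(1) unfolding G(2)[symmetric] by (auto intro: strict_monoD)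
  then have "\<forall>\<^sub>F i in L. cdf (D i) (a i + c i * (z - e / 2)) < u"
    "\<forall>\<^sub>F i in L. u < cdf (D i) (a i + c i * (z + e / 2))"
    using order_tendstoD[OF lim] by blast+
  with c show "\<forall>\<^sub>F i in L. dist ((quantile (D i) u - a i) / c i) z < e"
  proof eventually_elim
    case (elim i)
    interpret D: real_distribution "D i"
      by (rule D)
    have lower: "a i + c i * (z - e / 2) \<le> t" if "u \<le> cdf (D i) t" for t
      using that elim(2) D.cdf_nondecreasing[of t "a i + c i * (z - e / 2)"] by linarith
    \<comment> \<open>The infimum is a genuine one: \<open>lower\<close> bounds the set from below,
      and \<open>elim(3)\<close> supplies a member. Only weak inequalities result, whence
      \<open>e / 2\<close> instead of \<open>e\<close>.\<close>
    have upper: "quantile (D i) u \<le> a i + c i * (z + e / 2)"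
      unfolding quantile_def using elim(3) by (intro cInf_lower bdd_belowI[OF lower]) auto
    have "a i + c i * (z - e / 2) \<le> quantile (D i) u"
      unfolding quantile_def using elim(3) lower by (intro cInf_greatest) (auto intro: less_imp_le)
    with upper have "z - e / 2 \<le> (quantile (D i) u - a i) / c i"
      "(quantile (D i) u - a i) / c i \<le> z + e / 2"
      unfolding pos_le_divide_eq[OF elim(1)] pos_divide_le_eq[OF elim(1)]
      by (simp_all add: algebra_simps)
    then show ?case
      using \<open>0 < e\<close> by (simp add: dist_real_def abs_less_iff)
  qed
qed

section \<open>Asymptotic power of the F-test\<close>

theorem corollary2p2:
  fixes M :: "nat \<Rightarrow> 'a measure"
    and p q :: "nat \<Rightarrow> nat"
    and y :: "nat \<Rightarrow> nat \<Rightarrow> 'a \<Rightarrow> real"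
    and x :: "nat \<Rightarrow> nat \<Rightarrow> 'a \<Rightarrow> real Matrix.vec"
    and \<alpha> \<sigma> :: "nat \<Rightarrow> real"
    and \<beta> r \<mu> :: "nat \<Rightarrow> real Matrix.vec"
    and R \<Sigma> :: "nat \<Rightarrow> real Matrix.mat"
    and F :: "nat \<Rightarrow> 'a \<Rightarrow> real"
    and \<Delta> s b :: "nat \<Rightarrow> real"
    and \<nu> :: real
  assumes model: "\<And>n. n \<ge> 3 \<Longrightarrow>
      linear_model (M n) n (p n) (y n) (x n) (\<alpha> n) (\<beta> n) (\<sigma> n)"
    and restriction: "\<And>n. n \<ge> 3 \<Longrightarrow> linear_restriction (p n) (q n) (R n) (r n)"
    and \<mu>_eq: "\<And>n. \<mu> n = mean_vec (M n) (p n) (x n 1)"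
    and \<Sigma>_eq: "\<And>n. \<Sigma> n = cov_mat (M n) (p n) (x n 1)"
    and F_eq: "\<And>n \<omega>. F n \<omega> =
      F_stat n (p n) (q n) (R n) (r n) (design_mat n (p n) (x n) \<omega>) (response_vec n (y n) \<omega>)"
    and \<Delta>_eq: "\<And>n. \<Delta> n =
      noncentrality (R n) (r n) (moment_mat (\<mu> n) (\<Sigma> n)) (vCons (\<alpha> n) (\<beta> n)) (\<sigma> n)"
    and s_eq: "\<And>n. s n = 2 * (1 / real (q n) + 1 / (real n - real (p n) - 1))"
    and b_eq: "\<And>n. b n =
      sqrt ((1 - (real (p n) + 1) / real n) * (1 - (real (p n) + 1) / real n + real (q n) / real n)
            / (2 * real (q n) / real n))"
    and limsup_p: "limsup (\<lambda>n. ereal (real (p n) / real n)) < 1"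
    and q_tendsto: "filterlim q at_top sequentially"
    and clt: "weak_conv_m
      (\<lambda>n. distr (M n) borel
        (\<lambda>\<omega>. s n powr (- 1 / 2) * (F n \<omega> - 1) - sqrt (real n) * \<Delta> n * b n))
      std_normal_distribution"
    and \<nu>: "0 < \<nu>" "\<nu> < 1"
  shows "(\<lambda>n.
      measure (M n)
        {\<omega> \<in> space (M n). F n \<omega> > quantile (F_distribution (q n) (n - p n - 1)) (1 - \<nu>)}
      - std_normal_cdf
          (- inv_into UNIV std_normal_cdf (1 - \<nu>)
           + sqrt (real n) * \<Delta> n *
             sqrt ((1 - (real (p n) + 1) / real n)
                   * (1 - (real (p n) + 1) / real n + real (q n) / real n)
                   / (2 * real (q n) / real n))))
    \<longlonglongrightarrow> 0"
proof -
  define c where "c n = sqrt (real n) * \<Delta> n * b n" for n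
  define T where "T n \<omega> = s n powr (- 1 / 2) * (F n \<omega> - 1) - c n" for n \<omega>
  define D where "D n = distr (M n) borel (T n)" for n
  define f where "f n = quantile (F_distribution (q n) (n - p n - 1)) (1 - \<nu>)" for n
  define a where "a n = (f n - 1) / sqrt (s n)" for n
  define \<zeta> where "\<zeta> = inv_into UNIV std_normal_cdf (1 - \<nu>)"
  let ?m = "\<lambda>n. n - p n - 1"
  \<comment> \<open>The conditions \<open>0 < p\<close> and \<open>p + 1 < n\<close> force
    \<open>n\<close> to be at least 3, so facts about the model are asserted eventually.\<close>
  have large: "\<forall>\<^sub>F n in sequentially. 3 \<le> n"
    by (rule eventually_ge_at_top)
  have p_less: "p n + 1 < n" if "3 \<le> n" for n
    using model[OF that] by (rule linear_model.p_less)
  have m_real: "real (?m n) = real n - real (p n) - 1" if "3 \<le> n" for n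
    using p_less[OF that] by simp
  have s_pos: "0 < s n" if "3 \<le> n" for n
    using p_less[OF that] by (auto simp: s_eq intro!: add_nonneg_pos)

  have m_at_top: "filterlim ?m at_top sequentially"
  proof -
    \<comment> \<open>A constant strictly between the limsup and 1 leaves at least
      \<open>(1 - C) * n - 1\<close> degrees of freedom.\<close>
    obtain C where "limsup (\<lambda>n. ereal (real (p n) / real n)) < ereal C" and C: "C < 1"
      using ereal_dense2[OF limsup_p] by (auto simp: one_ereal_def)
    then have p_C: "\<forall>\<^sub>F n in sequentially. real (p n) / real n < C"
      by (auto dest: Limsup_lessD)
    have "filterlim (\<lambda>n. - 1 + (1 - C) * real n) at_top sequentially"
      using C by (intro filterlim_tendsto_add_at_top[OF tendsto_const]
          filterlim_tendsto_pos_mult_at_top[OF tendsto_const _ filterlim_real_sequentially]) auto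
    moreover have "\<forall>\<^sub>F n in sequentially. - 1 + (1 - C) * real n \<le> real (?m n)"
      using p_C large
    proof eventually_elim
      case (elim n)
      then have "real (p n) < C * real n"
        by (simp add: divide_less_eq)
      then show ?case
        unfolding m_real[OF elim(2)] by (simp add: algebra_simps)
    qed
    ultimately have "filterlim (\<lambda>n. real (?m n)) at_top sequentially"
      by (rule filterlim_at_top_mono)
    then show ?thesis
      by (simp add: filterlim_sequentially_iff_filterlim_real)
  qed

  have "std_normal_cdf \<zeta> = 1 - \<nu>"
    unfolding \<zeta>_def using \<nu> by (intro std_normal_cdf_inv_into) auto
  have a_lim: "a \<longlonglongrightarrow> \<zeta>"
    unfolding a_def f_def
  proof (rule tendsto_normalized_quantile[OF strict_mono_std_normal_cdf \<open>std_normal_cdf \<zeta> = 1 - \<nu>\<close>])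
    show "(\<lambda>n. cdf (F_distribution (q n) (?m n)) (1 + sqrt (s n) * t)) \<longlonglongrightarrow> std_normal_cdf t" for t
    \<comment> \<open>The limit theorem expresses the scale by natural-number subtraction,
      \<open>s_eq\<close> by real subtraction; \<open>m_real\<close> reconciles the two.\<close>
    proof (rule Lim_transform_eventually[OF F_distribution_clt[OF q_tendsto m_at_top]])
      show "\<forall>\<^sub>F n in sequentially.
          cdf (F_distribution (q n) (?m n)) (1 + sqrt (2 * (1 / real (q n) + 1 / real (?m n))) * t) =
          cdf (F_distribution (q n) (?m n)) (1 + sqrt (s n) * t)"
        using large by eventually_elim (simp only: s_eq m_real)
    qed
    show "real_distribution (F_distribution (q n) (?m n))" for n
      by (rule real_distribution_F)
    show "\<forall>\<^sub>F n in sequentially. 0 < sqrt (s n)"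
      using large by eventually_elim (simp add: s_pos)
  qed

  have cdf_D: "(\<lambda>n. cdf (D n) t) \<longlonglongrightarrow> std_normal_cdf t" for t
    using clt unfolding weak_conv_m_def weak_conv_def D_def T_def c_def
    by (simp add: isCont_std_normal_cdf)
  \<comment> \<open>Positive limiting mass of \<open>{..0}\<close> shows that \<open>D n\<close> is
    eventually not the null measure, hence that \<open>T n\<close> is measurable.\<close>
  have "0 < std_normal_cdf 0"
    using strict_mono_less[OF strict_mono_std_normal_cdf, of "-1" 0] std_normal.cdf_nonneg[of "-1"]
    by simp
  then have "\<forall>\<^sub>F n in sequentially. 0 < cdf (D n) 0"
    using order_tendstoD(1)[OF cdf_D] by blast
  with large have T_measurable: "\<forall>\<^sub>F n in sequentially. 3 \<le> n \<and> T n \<in> borel_measurable (M n)"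
  proof eventually_elim
    case (elim n)
    interpret linear_model "M n" n "p n" "y n" "x n" "\<alpha> n" "\<beta> n" "\<sigma> n"
      by (rule model[OF elim(1)])
    have "emeasure (D n) {..0} \<noteq> 0"
      using elim(2) by (auto simp: cdf_def measure_def)
    then show ?case
      using elim(1) unfolding D_def by (auto intro: measurable_if_distr_nonzero)
  qed
  then have D_real: "\<forall>\<^sub>F n in sequentially. real_distribution (D n)"
  proof eventually_elim
    case (elim n)
    interpret linear_model "M n" n "p n" "y n" "x n" "\<alpha> n" "\<beta> n" "\<sigma> n"
      using elim by (intro model) simp
    show ?case
      unfolding D_def using elim by (intro real_distribution_distr) simp
  qed
  have "uniform_limit UNIV (\<lambda>n. cdf (D n)) std_normal_cdf sequentially"
  proof (rule std_normal.uniform_limit_cdf[OF isCont_std_normal_cdf _ _ cdf_D])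
    show "\<forall>\<^sub>F n in sequentially. mono (cdf (D n))"
      using D_real
      by eventually_elim
        (intro monoI finite_borel_measure.cdf_nondecreasing real_distribution.finite_borel_measure_M)
    show "\<forall>\<^sub>F n in sequentially. \<forall>t. 0 \<le> cdf (D n) t \<and> cdf (D n) t \<le> 1"
      using D_real
      by eventually_elim (auto simp: cdf_def intro: real_distribution.cdf_bounded_prob[unfolded cdf_def])
  qed
  then have D_lim: "(\<lambda>n. cdf (D n) (a n - c n) - std_normal_cdf (a n - c n)) \<longlonglongrightarrow> 0"
    by (rule uniform_limit_diff_tendsto_zero)
  \<comment> \<open>Polya's theorem once more, now for shifted normal distribution functions: it
    allows \<open>a n\<close> to be replaced by \<open>\<zeta>\<close> at the points
    \<open>a n - c n\<close>, however large \<open>c n\<close> is.\<close>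
  have "uniform_limit UNIV (\<lambda>n t. std_normal_cdf (t + (a n - \<zeta>))) std_normal_cdf sequentially"
  proof (rule std_normal.uniform_limit_cdf[OF isCont_std_normal_cdf])
    fix t
    have "(\<lambda>n. t + (a n - \<zeta>)) \<longlonglongrightarrow> t + (\<zeta> - \<zeta>)"
      by (intro tendsto_intros a_lim)
    then show "(\<lambda>n. std_normal_cdf (t + (a n - \<zeta>))) \<longlonglongrightarrow> std_normal_cdf t"
      by (intro isCont_tendsto_compose[OF isCont_std_normal_cdf]) simp
  qed (auto intro!: always_eventually monoI std_normal.cdf_nondecreasing std_normal.cdf_nonneg
      std_normal.cdf_bounded_prob)
  from uniform_limit_diff_tendsto_zero[OF this, of "\<lambda>n. \<zeta> - c n"]
  have "(\<lambda>n. std_normal_cdf (a n - c n) - std_normal_cdf (\<zeta> - c n)) \<longlonglongrightarrow> 0"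
    by simp
  from tendsto_minus[OF tendsto_add[OF D_lim this]]
  have lim: "(\<lambda>n. (1 - cdf (D n) (a n - c n)) - (1 - std_normal_cdf (\<zeta> - c n))) \<longlonglongrightarrow> 0"
    by (simp add: algebra_simps)

  have "\<forall>\<^sub>F n in sequentially.
      measure (M n) {\<omega> \<in> space (M n). F n \<omega> > f n} = 1 - cdf (D n) (a n - c n)"
    using T_measurable
  proof eventually_elim
    case (elim n)
    interpret linear_model "M n" n "p n" "y n" "x n" "\<alpha> n" "\<beta> n" "\<sigma> n"
      using elim by (intro model) simp
    have [measurable]: "T n \<in> borel_measurable (M n)"
      using elim by simp
    have "0 < s n"
      using elim by (simp add: s_pos)
    then have "s n powr (- 1 / 2) = 1 / sqrt (s n)"
      using powr_minus_divide[of "s n" "1 / 2"] powr_half_sqrt[of "s n"] by simp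
    then have "T n \<omega> = (F n \<omega> - 1) / sqrt (s n) - c n" for \<omega>
      by (simp add: T_def)
    then have "f n < F n \<omega> \<longleftrightarrow> a n - c n < T n \<omega>" for \<omega>
      using \<open>0 < s n\<close> by (simp add: a_def divide_less_cancel)
    then have "{\<omega> \<in> space (M n). F n \<omega> > f n} = space (M n) - {\<omega> \<in> space (M n). T n \<omega> \<le> a n - c n}"
      by (simp add: set_eq_iff not_le cong: conj_cong)
    also have "prob \<dots> = 1 - prob {\<omega> \<in> space (M n). T n \<omega> \<le> a n - c n}"
      by (rule prob_compl) measurable
    also have "prob {\<omega> \<in> space (M n). T n \<omega> \<le> a n - c n} = cdf (D n) (a n - c n)"
      by (simp add: cdf_def D_def measure_distr vimage_def Int_def conj_commute)
    finally show ?case .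
  qed
  \<comment> \<open>By symmetry of the normal law, \<open>1 - std_normal_cdf (\<zeta> - c n)\<close>
    is the power in the form claimed.\<close>
  then have "\<forall>\<^sub>F n in sequentially.
      (1 - cdf (D n) (a n - c n)) - (1 - std_normal_cdf (\<zeta> - c n)) =
      measure (M n) {\<omega> \<in> space (M n). F n \<omega> > f n} - std_normal_cdf (- \<zeta> + c n)"
  proof eventually_elim
    case (elim n)
    then show ?case
      using std_normal_cdf_minus[of "\<zeta> - c n"] by (simp add: add.commute)
  qed
  with lim have
    "(\<lambda>n. measure (M n) {\<omega> \<in> space (M n). F n \<omega> > f n} - std_normal_cdf (- \<zeta> + c n)) \<longlonglongrightarrow> 0"
    by (rule Lim_transform_eventually)
  then show ?thesis
    by (simp only: f_def \<zeta>_def c_def b_eq)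
qed

end
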